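(* Let $n, k$ be positive integers with $n \ge 2k+1 \ge 3$, and let $S = a_1 \bullet \dots \bullet a_{n-k}$ be a zero-sum free sequence of length $n-k$ over $\mathbb{Z}_n$ such that $\sum_{i=1}^{n-k} \overline{a_i} \le n-1$, the sum being taken in the integers. Then $$\left\{ \sum_{i \in \Lambda} \overline{a_i} \;:\; \emptyset \ne \Lambda \subseteq \{1, \dots, n-k\} \right\} = \left\{ m \in \mathbb{N} \;:\; 1 \le m \le \sum_{i=1}^{n-k} \overline{a_i} \right\},$$ where the sums are taken in the integers. In other words, for every integer $t$ with $1 \le t \le \sum_{i=1}^{n-k} \overline{a_i}$ there exists a non-empty subsequence $a_{i_1} \bullet \dots \bullet a_{i_r}$ of $S$ (with distinct indices $i_1, \dots, i_r$) such that $\sum_{j=1}^{r} \overline{a_{i_j}} = t$.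
   Context: $\mathbb{Z}_n$ is the cyclic group of order $n$, written additively (the integers modulo $n$). For $a \in \mathbb{Z}_n$, $\overline{a}$ denotes the least positive integer in the congruence class $a$ modulo $n$ (so $\overline{a} \in \{1, \dots, n\}$). A sequence $S = a_1 \bullet \dots \bullet a_m$ over $\mathbb{Z}_n$ is a finite unordered list of elements of $\mathbb{Z}_n$ with repetition allowed (a finite multiset); $m$ is its length. A subsequence is a sub-multiset. $S$ is zero-sum free if no non-empty subsequence of $S$ has sum equal to $0$ in $\mathbb{Z}_n$. *)

theory Defs
  imports "HOL-Algebra.Elementary_Groups" "HOL-Algebra.FiniteProduct" "HOL-Number_Theory.Cong"
begin

text \<open>A sequence over a commutative group \<open>G\<close> is a family \<open>a\<close> indexed by a finite set \<open>I\<close>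
  with values in \<open>carrier G\<close>, and its subsequences are given by the subsets of \<open>I\<close>.
  The library writes the operation of \<open>integer_mod_group n\<close> multiplicatively, so for that group
  \<open>finprod\<close> is the sum modulo \<open>n\<close> and \<open>\<one>\<close> is the residue class of \<open>0\<close>.\<close>

definition zero_sum_free :: "('g, 'b) monoid_scheme \<Rightarrow> 'i set \<Rightarrow> ('i \<Rightarrow> 'g) \<Rightarrow> bool" where
  "zero_sum_free G I a \<longleftrightarrow>
     (\<forall>\<Lambda>. \<Lambda> \<subseteq> I \<and> \<Lambda> \<noteq> {} \<longrightarrow> finprod G a \<Lambda> \<noteq> \<one>\<^bsub>G\<^esub>)"

text \<open>An element of \<open>integer_mod_group n\<close> is a residue in \<open>{0..<n}\<close>, standing for its congruence
  class. The least positive representative of the class of \<open>0\<close> is \<open>n\<close>.\<close>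

definition least_pos_rep :: "nat \<Rightarrow> int \<Rightarrow> nat" where
  "least_pos_rep n x = (LEAST m. 0 < m \<and> [int m = x] (mod int n))"

end

theory Submission
  imports Defs
begin

text \<open>This is a counting fact about positive integers. Put \<open>m = n - k\<close>. From \<open>n \<ge> 2 * k + 1\<close> one
  gets \<open>k < m\<close>, so the \<open>m\<close> positive integers \<open>least_pos_rep n (a i)\<close> have sum at most
  \<open>n - 1 = m + k - 1 < 2 * m\<close>: their average is below 2. Such a family realises every integer
  between 0 and its total as a subset sum (\<open>subset_sums_cover\<close>). To see this, set aside a largest
  term \<open>x\<close>. The remaining terms satisfy the same bound, so by induction their subset sums fill an
  initial interval, and this interval reaches at least \<open>x - 1\<close>; with \<open>x\<close> added to it, its translate
  continues it without a gap up to the total.\<close>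

lemma least_pos_rep_pos:
  assumes "0 < n"
  shows "0 < least_pos_rep n x"
proof -
  let ?P = "\<lambda>m. 0 < m \<and> [int m = x] (mod int n)"
  have "?P (nat (x mod int n) + n)"
    using assms by (simp add: cong_def)
  then have "?P (LEAST m. ?P m)"
    by (rule LeastI)
  then show ?thesis
    by (simp add: least_pos_rep_def)
qed

text \<open>The bound \<open>2 * card I - 1\<close> is truncated at 0 for empty \<open>I\<close>, where it still holds, so the
  induction can start there. Removing a largest term preserves the bound: a term \<open>\<ge> 2\<close> takes away
  at least as much as the bound drops, and if the largest term is 1, then the sum equals the number
  of terms.\<close>

lemma subset_sums_cover:
  fixes b :: "'i \<Rightarrow> nat"
  assumes "finite I" and "\<And>i. i \<in> I \<Longrightarrow> 0 < b i"
    and "sum b I \<le> 2 * card I - 1" and "t \<le> sum b I"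
  shows "\<exists>\<Lambda>\<subseteq>I. sum b \<Lambda> = t"
  using assms
proof (induction "card I" arbitrary: I t)
  case 0
  then show ?case by auto
next
  case (Suc c)
  have "I \<noteq> {}"
    using Suc.hyps(2) by auto
  then have "Max (b ` I) \<in> b ` I"
    using Suc.prems(1) by simp
  then obtain x where x: "x \<in> I" and "b x = Max (b ` I)"
    by auto
  then have max: "b i \<le> b x" if "i \<in> I" for i
    using that Suc.prems(1) by simp
  let ?J = "I - {x}"
  have fin: "finite ?J" and card: "card ?J = c"
    using Suc.prems(1) Suc.hyps(2) x by auto
  have split: "sum b I = b x + sum b ?J"
    using Suc.prems(1) x by (rule sum.remove)
  have "(\<Sum>i\<in>?J. 1) \<le> sum b ?J"
    using Suc.prems(2) by (intro sum_mono) (simp add: Suc_le_eq)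
  then have lower: "c \<le> sum b ?J"
    using card by simp
  have total: "sum b I \<le> 2 * c + 1"
    using Suc.prems(3) Suc.hyps(2) by simp
  have bound: "sum b ?J \<le> 2 * card ?J - 1"
  proof (cases "b x \<ge> 2")
    case True
    then show ?thesis
      using total split card by simp
  next
    case False
    have "sum b ?J \<le> (\<Sum>i\<in>?J. 1)"
      using max False by (intro sum_mono) fastforce
    then show ?thesis
      using card by simp
  qed
  have IH: "\<exists>\<Lambda>\<subseteq>?J. sum b \<Lambda> = u" if "u \<le> sum b ?J" for u
    using Suc.hyps(1)[OF card[symmetric] fin _ bound that] Suc.prems(2) by simp
  show ?case
  proof (cases "t \<le> sum b ?J")
    case True
    then show ?thesis
      using IH by blast
  next
    case False
    \<comment> \<open>The other \<open>c\<close> terms sum to at least \<open>c\<close>, and the total is at most \<open>2 * c + 1\<close>, so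
      \<open>b x \<le> c + 1\<close>: the interval already covered ends at \<open>b x - 1\<close> or later.\<close>
    then have "b x \<le> t"
      using total split lower by linarith
    moreover have "t - b x \<le> sum b ?J"
      using Suc.prems(4) split by linarith
    then obtain \<Lambda> where \<Lambda>: "\<Lambda> \<subseteq> ?J" "sum b \<Lambda> = t - b x"
      using IH by blast
    moreover have "sum b (insert x \<Lambda>) = b x + sum b \<Lambda>"
      using \<Lambda>(1) finite_subset[OF \<Lambda>(1) fin] by (intro sum.insert) auto
    ultimately have "insert x \<Lambda> \<subseteq> I" "sum b (insert x \<Lambda>) = t"
      using x by auto
    then show ?thesis
      by blast
  qed
qed

theorem theorem3p1:
  fixes n k :: nat and a :: "nat \<Rightarrow> int"
  assumes "n \<ge> 2 * k + 1" and "2 * k + 1 \<ge> 3"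
    and "a \<in> {1..n - k} \<rightarrow> carrier (integer_mod_group n)"
    and "zero_sum_free (integer_mod_group n) {1..n - k} a"
    and "(\<Sum>i\<in>{1..n - k}. least_pos_rep n (a i)) \<le> n - 1"
  shows "{\<Sum>i\<in>\<Lambda>. least_pos_rep n (a i) | \<Lambda>. \<Lambda> \<noteq> {} \<and> \<Lambda> \<subseteq> {1..n - k}}
       = {m::nat. 1 \<le> m \<and> m \<le> (\<Sum>i\<in>{1..n - k}. least_pos_rep n (a i))}"
proof -
  define b where "b = (\<lambda>i. least_pos_rep n (a i))"
  let ?I = "{1..n - k}"
  have pos: "0 < b i" for i
    using assms(1) by (simp add: b_def least_pos_rep_pos)
  have bound: "sum b ?I \<le> 2 * card ?I - 1"
    using assms(1,5) by (simp add: b_def)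
  have "{sum b \<Lambda> | \<Lambda>. \<Lambda> \<noteq> {} \<and> \<Lambda> \<subseteq> ?I} = {m. 1 \<le> m \<and> m \<le> sum b ?I}"
  proof (intro equalityI subsetI)
    fix m assume "m \<in> {sum b \<Lambda> | \<Lambda>. \<Lambda> \<noteq> {} \<and> \<Lambda> \<subseteq> ?I}"
    then obtain \<Lambda> where \<Lambda>: "\<Lambda> \<noteq> {}" "\<Lambda> \<subseteq> ?I" and m: "m = sum b \<Lambda>"
      by blast
    have "0 < sum b \<Lambda>"
      using \<Lambda> pos by (intro sum_pos) (auto intro: finite_subset)
    moreover have "sum b \<Lambda> \<le> sum b ?I"
      using \<Lambda>(2) by (intro sum_mono2) auto
    ultimately show "m \<in> {m. 1 \<le> m \<and> m \<le> sum b ?I}"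
      using m by simp
  next
    fix m assume m: "m \<in> {m. 1 \<le> m \<and> m \<le> sum b ?I}"
    then obtain \<Lambda> where \<Lambda>: "\<Lambda> \<subseteq> ?I" "sum b \<Lambda> = m"
      using subset_sums_cover[of ?I b m] pos bound by auto
    moreover have "\<Lambda> \<noteq> {}"
      using \<Lambda>(2) m by auto
    ultimately show "m \<in> {sum b \<Lambda> | \<Lambda>. \<Lambda> \<noteq> {} \<and> \<Lambda> \<subseteq> ?I}"
      by blast
  qed
  then show ?thesis
    by (simp only: b_def)
qed

end
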